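(* Let $A\subset\mathbb{R}$ be a finite set. Then for all but at most one value $x\in\mathbb{R}$, $$|(A+A)(A+x)|\gg \frac{|A|^{11/7}}{(\log|A|)^{3/7}},$$ where $(A+A)(A+x)=\{(b+c)(d+x): b,c,d\in A\}$.
   Context: $X\gg Y$ means $X\geq cY$ for some absolute constant $c>0$ (independent of $A$ and $x$). Logarithms are to base 2. *)

theory Defs
  imports Complex_Main
begin

definition sumprod_set :: "real set \<Rightarrow> real \<Rightarrow> real set" where
  "sumprod_set A x = {(b + c) * (d + x) | b c d. b \<in> A \<and> c \<in> A \<and> d \<in> A}"

end

theory Submission
  imports Defs "HOL-Analysis.Harmonic_Numbers"
begin

text \<open>
  Fix \<open>x \<noteq> y\<close>, let \<open>N = |A|\<close>, \<open>M = |A + A|\<close>, let \<open>P\<close> be the larger of the two cardinalities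
  belonging to \<open>x\<close> and \<open>y\<close>, and let \<open>B\<close> be the positive part of \<open>A + x\<close>
  (after negating \<open>A\<close>, \<open>x\<close>, \<open>y\<close> if necessary, it has at least \<open>N / 4\<close> elements). Let \<open>S t\<close> be the set of ratios
  \<open>q\<close> with at least \<open>t\<close> representations \<open>q = b / b'\<close> in \<open>B\<close>. Then \<open>t |S t| \<le> N\<^sup>2\<close> trivially,
  \<open>t\<^sup>2 |S t| \<lesssim> M\<^sup>2\<close> by Solymosi's argument, and \<open>t\<^sup>3 |S t| \<lesssim> N\<^sup>2 P\<^sup>2 / M\<close> because each of the
  \<open>|S t| (M - 1)\<close> or more lines \<open>v = d (q u + y - x)\<close>, with \<open>q \<in> S t\<close> and \<open>d \<in> A + A\<close> nonzero, contains \<open>t\<close>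
  points of the grid \<open>B \<times> (A + A)(A + y)\<close>. Summing over \<open>t\<close>, these bounds give
  \<open>(\<Sum>t. sqrt |S t|) \<lesssim> N sqrt P / M^(1/4)\<close> as well as \<open>(\<Sum>t. sqrt |S t|) \<lesssim> M log N\<close>.
  On the other hand, Cauchy--Schwarz for the map \<open>b (c + d)\<close> on \<open>B \<times> A \<times> A\<close>, together with the bound
  \<open>N\<^sup>3 sqrt |S|\<close> (up to a constant) for the number of solutions of \<open>c + d = q (c' + d')\<close> with \<open>q \<in> S\<close>, yields
  \<open>N\<^sup>3 \<lesssim> P (\<Sum>t. sqrt |S t|)\<close>. Eliminating \<open>M\<close> gives \<open>N^11 \<lesssim> P^7 log N\<close>.

  All incidence bounds are for Cartesian products, where the Szemeredi--Trotter estimate for rich lines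
  follows by cutting both factors into about \<open>t / 4\<close> blocks: a line meets at most \<open>t / 2\<close> cells, so it
  contains at least \<open>t / 2\<close> pairs of points within cells, and there are few such pairs altogether and each determines
  its line.
\<close>

section \<open>Rich lines in Cartesian products\<close>

text \<open>Grid points on the line are counted by abscissa. With \<open>X = Y = B\<close>,
  \<open>b = 0\<close> and \<open>0 \<notin> B\<close> this is the number of representations of
  \<open>a\<close> as a ratio of elements of \<open>B\<close>.\<close>

definition line_count :: "real set \<Rightarrow> real set \<Rightarrow> real \<Rightarrow> real \<Rightarrow> nat" where
  "line_count X Y a b = card {u \<in> X. a * u + b \<in> Y}"

text \<open>Blocks are runs of \<open>s\<close> consecutive elements, with \<open>s\<close> the
  ceiling of \<open>n / r\<close>. An element has at most \<open>s\<close> partners in its block,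
  and \<open>r * s \<le> 2 * n\<close>.\<close>

lemma ex_block_partition:
  fixes X :: "real set"
  assumes "finite X" "1 \<le> r" "r \<le> card X"
  shows "\<exists>\<beta>::real \<Rightarrow> nat. mono_on X \<beta> \<and> (\<forall>u\<in>X. \<beta> u < r) \<and>
           r * card {(u, v) \<in> X \<times> X. \<beta> u = \<beta> v} \<le> 2 * (card X)\<^sup>2"
proof -
  define n where "n = card X"
  define s where "s = (n + r - 1) div r"
  define rank where "rank u = card {v \<in> X. v < u}" for u :: real
  define \<beta> where "\<beta> u = rank u div s" for u :: real
  have rs: "r * s \<le> n + r - 1"
    unfolding s_def by simp
  have "n + r - 1 = r * s + (n + r - 1) mod r"
    unfolding s_def by simp
  moreover have "(n + r - 1) mod r < r" using assms by simp
  ultimately have ns: "n \<le> r * s" using assms by linarith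
  have s: "s > 0" using ns assms unfolding n_def by (cases "s = 0") auto
  have mono: "rank u \<le> rank v" if "u \<le> v" for u v
    unfolding rank_def by (rule card_mono) (use that assms in auto)
  have "rank u < rank v" if "u \<in> X" "u < v" for u v
    unfolding rank_def by (rule psubset_card_mono) (use that assms in auto)
  then have inj: "inj_on rank X"
    by (metis linorder_inj_onI' nat_neq_iff)
  have rank_less: "rank u < n" if "u \<in> X" for u
    unfolding rank_def n_def by (rule psubset_card_mono) (use that assms in auto)
  have less: "\<beta> u < r" if "u \<in> X" for u
    unfolding \<beta>_def using rank_less[OF that] ns s
    by (simp add: less_mult_imp_div_less mult.commute)
  have "mono_on X \<beta>"
    by (intro mono_onI) (simp add: \<beta>_def div_le_mono mono)
  have fibre: "card {v \<in> X. \<beta> u = \<beta> v} \<le> s" for u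
  proof -
    have "card {v \<in> X. \<beta> u = \<beta> v} \<le> card {\<beta> u * s..<\<beta> u * s + s}"
    proof (rule card_inj_on_le[where f = rank])
      show "inj_on rank {v \<in> X. \<beta> u = \<beta> v}" using inj by (auto simp: inj_on_def)
      show "rank ` {v \<in> X. \<beta> u = \<beta> v} \<subseteq> {\<beta> u * s..<\<beta> u * s + s}"
      proof clarify
        fix v assume "\<beta> u = \<beta> v"
        then show "rank v \<in> {\<beta> u * s..<\<beta> u * s + s}"
          using s by (simp add: \<beta>_def) (metis add.commute dividend_less_div_times)
      qed
    qed simp
    then show ?thesis by simp
  qed
  have "(\<Sum>u\<in>X. card {v \<in> X. \<beta> u = \<beta> v}) \<le> n * s"
    unfolding n_def using sum_bounded_above[of X "\<lambda>u. card {v \<in> X. \<beta> u = \<beta> v}" s] fibre by simp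
  also have "(\<Sum>u\<in>X. card {v \<in> X. \<beta> u = \<beta> v}) = card (SIGMA u:X. {v \<in> X. \<beta> u = \<beta> v})"
    using assms by simp
  also have "(SIGMA u:X. {v \<in> X. \<beta> u = \<beta> v}) = {(u, v) \<in> X \<times> X. \<beta> u = \<beta> v}" by auto
  finally have "card {(u, v) \<in> X \<times> X. \<beta> u = \<beta> v} \<le> n * s" .
  then have "r * card {(u, v) \<in> X \<times> X. \<beta> u = \<beta> v} \<le> r * (n * s)" by simp
  also have "\<dots> = n * (r * s)" by simp
  also have "\<dots> \<le> n * (2 * n)" by (rule mult_left_mono) (use rs assms n_def in auto)
  finally have "r * card {(u, v) \<in> X \<times> X. \<beta> u = \<beta> v} \<le> 2 * (card X)\<^sup>2"
    by (simp add: n_def power2_eq_square)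
  then show ?thesis using less \<open>mono_on X \<beta>\<close> by blast
qed

text \<open>One representative per fibre accounts for the image; every other element collides with
  its representative.\<close>

lemma card_le_card_image_plus_collisions:
  assumes "finite U"
  shows "card U \<le> card (h ` U) + card {(u, v) \<in> U \<times> U. u \<noteq> v \<and> h u = h v}"
proof -
  define rep where "rep u = inv_into U h (h u)" for u
  define V where "V = {u \<in> U. rep u \<noteq> u}"
  have rep: "rep u \<in> U" "h (rep u) = h u" if "u \<in> U" for u
    using that by (auto simp: rep_def inv_into_into f_inv_into_f)
  have "U \<subseteq> inv_into U h ` h ` U \<union> V"
    by (force simp: V_def rep_def image_iff)
  then have "card U \<le> card (inv_into U h ` h ` U \<union> V)"
    using assms by (intro card_mono) (auto simp: V_def)
  also have "\<dots> \<le> card (inv_into U h ` h ` U) + card V" by (rule card_Un_le)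
  also have "card (inv_into U h ` h ` U) \<le> card (h ` U)"
    using assms by (intro card_image_le) auto
  also have "card V \<le> card {(u, v) \<in> U \<times> U. u \<noteq> v \<and> h u = h v}"
  proof (rule card_inj_on_le[where f = "\<lambda>u. (u, rep u)"])
    show "(\<lambda>u. (u, rep u)) ` V \<subseteq> {(u, v) \<in> U \<times> U. u \<noteq> v \<and> h u = h v}"
      using rep by (auto simp: V_def)
    show "finite {(u, v) \<in> U \<times> U. u \<noteq> v \<and> h u = h v}"
      by (rule finite_subset[of _ "U \<times> U"]) (use assms in auto)
  qed (auto simp: inj_on_def)
  finally show ?thesis by simp
qed

lemma line_same_cell_pairs:
  fixes X Y :: "real set"
  assumes "finite X" "a \<noteq> 0" "1 \<le> r"
    and bX: "mono_on X \<beta>" "\<forall>u\<in>X. \<beta> u < r" and bY: "mono_on Y \<gamma>" "\<forall>v\<in>Y. \<gamma> v < (r::nat)"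
  shows "line_count X Y a b + 1 \<le> 2 * r + card {(u, v) \<in> X \<times> X. a * u + b \<in> Y \<and> a * v + b \<in> Y \<and>
     u \<noteq> v \<and> \<beta> u = \<beta> v \<and> \<gamma> (a * u + b) = \<gamma> (a * v + b)}"
proof -
  define U where "U = {u \<in> X. a * u + b \<in> Y}"
  \<comment> \<open>The cells met by a monotone curve form a chain, so the sum of the two block indices tells them apart.\<close>
  define h where "h u = \<beta> u + (if a > 0 then \<gamma> (a * u + b) else r - 1 - \<gamma> (a * u + b))" for u
  have finU: "finite U" using assms by (simp add: U_def)
  \<comment> \<open>Both summands are at most \<open>r - 1\<close>, so \<open>h\<close> has
    \<open>2 * r - 1\<close> possible values. The saved unit is the \<open>+ 1\<close> in the
    statement; it gives exactly \<open>t / 2\<close> same-cell pairs per line later, even for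
    \<open>t = 2\<close>.\<close>
  have h_less: "h u < 2 * r - 1" if "u \<in> U" for u
    using that assms by (fastforce simp: h_def U_def)
  have cell: "\<beta> u = \<beta> v \<and> \<gamma> (a * u + b) = \<gamma> (a * v + b)" if "u \<in> U" "v \<in> U" "h u = h v" "u \<le> v" for u v
  proof -
    have *: "\<beta> u \<le> \<beta> v" using bX that by (auto simp: mono_on_def U_def)
    have lt: "\<gamma> (a * u + b) < r" "\<gamma> (a * v + b) < r" using bY that by (auto simp: U_def)
    show ?thesis
    proof (cases "a > 0")
      case True
      then have "\<gamma> (a * u + b) \<le> \<gamma> (a * v + b)" using bY that by (auto simp: mono_on_def U_def)
      then show ?thesis using * that True by (simp add: h_def)
    next
      case False
      then have "a * v + b \<le> a * u + b" using that by (simp add: mult_left_mono_neg)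
      then have "\<gamma> (a * v + b) \<le> \<gamma> (a * u + b)" using bY that by (auto simp: mono_on_def U_def)
      then show ?thesis using * that False lt by (simp add: h_def) linarith
    qed
  qed
  have cell': "\<beta> u = \<beta> v \<and> \<gamma> (a * u + b) = \<gamma> (a * v + b)" if "u \<in> U" "v \<in> U" "h u = h v" for u v
    using cell[of u v] cell[of v u] that by (metis linear)
  have "h ` U \<subseteq> {..<2 * r - 1}" using h_less by auto
  then have "card (h ` U) \<le> 2 * r - 1" using card_mono[of "{..<2 * r - 1}" "h ` U"] by simp
  moreover have "card {(u, v) \<in> U \<times> U. u \<noteq> v \<and> h u = h v} \<le> card {(u, v) \<in> X \<times> X. a * u + b \<in> Y \<and> a * v + b \<in> Y \<and>
     u \<noteq> v \<and> \<beta> u = \<beta> v \<and> \<gamma> (a * u + b) = \<gamma> (a * v + b)}"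
  proof (rule card_mono)
    show "finite {(u, v) \<in> X \<times> X. a * u + b \<in> Y \<and> a * v + b \<in> Y \<and>
     u \<noteq> v \<and> \<beta> u = \<beta> v \<and> \<gamma> (a * u + b) = \<gamma> (a * v + b)}"
      by (rule finite_subset[of _ "X \<times> X"]) (use assms in auto)
  next
    show "{(u, v) \<in> U \<times> U. u \<noteq> v \<and> h u = h v} \<subseteq> {(u, v) \<in> X \<times> X. a * u + b \<in> Y \<and> a * v + b \<in> Y \<and>
     u \<noteq> v \<and> \<beta> u = \<beta> v \<and> \<gamma> (a * u + b) = \<gamma> (a * v + b)}"
      using cell' by (auto simp: U_def)
  qed
  ultimately show ?thesis
    using card_le_card_image_plus_collisions[OF finU, of h] assms(3)
    unfolding line_count_def U_def[symmetric] by linarith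
qed

text \<open>Double counting of same-cell pairs of points on lines: each line carries at least
  \<open>t / 2\<close>, while at most \<open>(2 * |X|^2 / r) * (2 * |Y|^2 / r)\<close> are
  available.\<close>

lemma rich_lines_grid:
  fixes X Y :: "real set" and L :: "(real \<times> real) set"
  assumes "finite X" "finite Y" "finite L" "2 \<le> t"
    and L: "\<And>a b. (a, b) \<in> L \<Longrightarrow> a \<noteq> 0 \<and> t \<le> line_count X Y a b"
  shows "real (card L) * real t ^ 3 \<le> 512 * real (card X)^2 * real (card Y)^2"
proof (cases "L = {}")
  case False
  then obtain a0 b0 where L0: "(a0, b0) \<in> L" by auto
  \<comment> \<open>The bound \<open>4 * r \<le> t + 2\<close> leaves enough points outside the cell
    count; \<open>t \<le> 8 * r\<close> turns \<open>r\<^sup>2\<close> back into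
    \<open>t\<^sup>2\<close> at the cost of a factor 64.\<close>
  define r where "r = (t + 2) div 4"
  have r: "1 \<le> r" "4 * r \<le> t + 2" "t \<le> 8 * r" using \<open>2 \<le> t\<close> by (auto simp: r_def)
  have "t \<le> card X"
    using L[OF L0] card_mono[of X "{u \<in> X. a0 * u + b0 \<in> Y}"] assms(1) by (auto simp: line_count_def)
  moreover have "t \<le> card Y"
  proof -
    have "card {u \<in> X. a0 * u + b0 \<in> Y} \<le> card Y"
      by (rule card_inj_on_le[where f = "\<lambda>u. a0 * u + b0"]) (use L[OF L0] assms in \<open>auto simp: inj_on_def\<close>)
    then show ?thesis using L[OF L0] by (simp add: line_count_def)
  qed
  ultimately have rn: "r \<le> card X" "r \<le> card Y" using r \<open>2 \<le> t\<close> by auto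
  obtain \<beta> where bX: "mono_on X \<beta>" "\<forall>u\<in>X. \<beta> u < r"
      "r * card {(u, v) \<in> X \<times> X. \<beta> u = \<beta> v} \<le> 2 * (card X)\<^sup>2"
    using ex_block_partition[OF assms(1) r(1) rn(1)] by auto
  obtain \<gamma> where bY: "mono_on Y \<gamma>" "\<forall>u\<in>Y. \<gamma> u < r"
      "r * card {(u, v) \<in> Y \<times> Y. \<gamma> u = \<gamma> v} \<le> 2 * (card Y)\<^sup>2"
    using ex_block_partition[OF assms(2) r(1) rn(2)] by auto
  define W where "W = (\<lambda>(a, b). {(u, v) \<in> X \<times> X. a * u + b \<in> Y \<and> a * v + b \<in> Y \<and>
     u \<noteq> v \<and> \<beta> u = \<beta> v \<and> \<gamma> (a * u + b) = \<gamma> (a * v + b)})"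
  have finW: "finite (W l)" for l
    by (rule finite_subset[of _ "X \<times> X"]) (use assms in \<open>auto simp: W_def split: prod.splits\<close>)
  have W: "t \<le> 2 * card (W l)" if "l \<in> L" for l
  proof -
    obtain a b where l: "l = (a, b)" by (cases l)
    then have "line_count X Y a b + 1 \<le> 2 * r + card (W l)"
      using line_same_cell_pairs[OF assms(1) _ r(1) bX(1,2) bY(1,2), of a b] L that by (simp add: W_def)
    moreover have "t \<le> line_count X Y a b" using L that l by auto
    ultimately show ?thesis using r by linarith
  qed
  let ?PX = "{(u, v) \<in> X \<times> X. \<beta> u = \<beta> v}" and ?PY = "{(u, v) \<in> Y \<times> Y. \<gamma> u = \<gamma> v}"
  have finP: "finite ?PX" "finite ?PY"
    by (rule finite_subset[of _ "X \<times> X"] finite_subset[of _ "Y \<times> Y"]; use assms in auto)+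
  have "card L * t \<le> (\<Sum>l\<in>L. 2 * card (W l))"
    using sum_bounded_below[of L t "\<lambda>l. 2 * card (W l)"] W by auto
  also have "\<dots> = 2 * card (Sigma L W)"
    using assms(3) finW by (simp add: sum_distrib_left)
  also have "card (Sigma L W) \<le> card (?PX \<times> ?PY)"
  \<comment> \<open>Two points with distinct abscissas determine their line, so
    \<open>(a, b)\<close> can be recovered from the image.\<close>
  proof (rule card_inj_on_le[where f = "\<lambda>((a, b), (u, v)). ((u, v), (a * u + b, a * v + b))"])
    show "inj_on (\<lambda>((a, b), (u, v)). ((u, v), (a * u + b, a * v + b))) (Sigma L W)"
    proof (rule inj_onI, clarsimp)
      fix a b u v a' b'
      assume "(u, v) \<in> W (a, b)" and eq: "a * u + b = a' * u + b'" "a * v + b = a' * v + b'"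
      then have "u \<noteq> v" by (simp add: W_def)
      moreover from eq have "(a - a') * (u - v) = 0" by (simp add: algebra_simps)
      ultimately show "a = a' \<and> b = b'" using eq by simp
    qed
  qed (use finP in \<open>auto simp: W_def\<close>)
  finally have main: "card L * t \<le> 2 * (card ?PX * card ?PY)" by (simp add: card_cartesian_product)
  have "card L * t * r\<^sup>2 \<le> 2 * (card ?PX * card ?PY) * r\<^sup>2" using main by (rule mult_right_mono) simp
  also have "\<dots> = 2 * ((r * card ?PX) * (r * card ?PY))" by (simp add: power2_eq_square)
  also have "\<dots> \<le> 2 * ((2 * (card X)\<^sup>2) * (2 * (card Y)\<^sup>2))"
    by (rule mult_left_mono[OF mult_mono[OF bX(3) bY(3)]]) simp_all
  finally have *: "card L * t * r\<^sup>2 \<le> 8 * (card X)\<^sup>2 * (card Y)\<^sup>2" by simp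
  have "card L * t ^ 3 = card L * t * t\<^sup>2" by (simp add: power3_eq_cube power2_eq_square)
  also have "\<dots> \<le> card L * t * (8 * r)\<^sup>2" using r by (intro mult_left_mono power_mono) auto
  also have "\<dots> = 64 * (card L * t * r\<^sup>2)" by (simp add: power2_eq_square)
  also have "\<dots> \<le> 64 * (8 * (card X)\<^sup>2 * (card Y)\<^sup>2)" using * by (rule mult_left_mono) simp
  finally have "card L * t ^ 3 \<le> 512 * (card X)\<^sup>2 * (card Y)\<^sup>2" by simp
  then have "real (card L * t ^ 3) \<le> real (512 * (card X)\<^sup>2 * (card Y)\<^sup>2)" by (rule of_nat_mono)
  then show ?thesis by simp
qed simp

section \<open>Energies and dilates\<close>

lemma sum_inverse_squares_tail:
  assumes "1 \<le> (\<Delta>::nat)"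
  shows "(\<Sum>k\<in>{\<Delta><..m}. 1 / real k ^ 2) \<le> 1 / \<Delta>"
proof (cases "\<Delta> \<le> m")
  case True
  have "(\<Sum>k\<in>{\<Delta><..m}. 1 / real k ^ 2) \<le> 1 / \<Delta> - 1 / m"
    using True
  proof (induction m rule: dec_induct)
    case (step n)
    have n: "real n > 0" using step assms by simp
    have "{\<Delta><..Suc n} = insert (Suc n) {\<Delta><..n}" using step by auto
    moreover have "1 / real (Suc n) ^ 2 \<le> 1 / n - 1 / Suc n"
      using n by (simp add: divide_simps power2_eq_square)
    ultimately show ?case using step by simp
  qed simp
  then show ?thesis by (smt (verit) of_nat_0_le_iff zero_le_divide_1_iff)
qed simp

text \<open>Layer-cake argument: the part of \<open>i\<^sup>2\<close> above
  \<open>\<Delta> * i\<close> is at most the sum of \<open>2 * k\<close> over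
  \<open>\<Delta> < k \<le> i\<close>. After swapping sums, richness bounds layer \<open>k\<close>
  by \<open>2 * b / k\<^sup>2\<close>.\<close>

lemma second_moment_from_rich:
  fixes i :: "'a \<Rightarrow> nat"
  assumes W: "finite W" and le: "\<And>w. w \<in> W \<Longrightarrow> i w \<le> m" and \<Delta>: "1 \<le> (\<Delta>::nat)"
    and rich: "\<And>k. 2 \<le> k \<Longrightarrow> real (card {w \<in> W. k \<le> i w}) * real k ^ 3 \<le> b"
  shows "(\<Sum>w\<in>W. real (i w) ^ 2) \<le> \<Delta> * (\<Sum>w\<in>W. real (i w)) + 2 * b / \<Delta>"
proof -
  have gauss: "real j * (j + 1) - real \<Delta> * (\<Delta> + 1) = (\<Sum>k\<in>{\<Delta><..j}. 2 * real k)" if "\<Delta> \<le> j" for j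
    using that
  proof (induction j rule: dec_induct)
    case (step n)
    have "{\<Delta><..Suc n} = insert (Suc n) {\<Delta><..n}" using step by auto
    then show ?case using step by (simp add: algebra_simps)
  qed simp
  have pt: "real (i w) ^ 2 \<le> \<Delta> * real (i w) + (\<Sum>k\<in>{\<Delta><..m}. if k \<le> i w then 2 * real k else 0)" if "w \<in> W" for w
  proof (cases "\<Delta> \<le> i w")
    case True
    have "{k \<in> {\<Delta><..m}. k \<le> i w} = {\<Delta><..i w}" using le[OF that] by auto
    then have "(\<Sum>k\<in>{\<Delta><..m}. if k \<le> i w then 2 * real k else 0) = real (i w) * (i w + 1) - real \<Delta> * (\<Delta> + 1)"
      using gauss[OF True] by (simp add: sum.inter_filter[symmetric])
    \<comment> \<open>This product is exactly the slack in the pointwise bound.\<close>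
    moreover have "(real \<Delta> + 1) * (real (i w) - real \<Delta>) \<ge> 0" using True by simp
    ultimately show ?thesis by (simp add: algebra_simps power2_eq_square)
  next
    case False
    then have "real (i w) * real (i w) \<le> \<Delta> * real (i w)" by (intro mult_right_mono) auto
    moreover have "0 \<le> (\<Sum>k\<in>{\<Delta><..m}. if k \<le> i w then 2 * real k else 0)" by (intro sum_nonneg) auto
    ultimately show ?thesis by (simp add: power2_eq_square)
  qed
  have b: "0 \<le> b" using rich[of 2] by (smt (verit) mult_nonneg_nonneg of_nat_0_le_iff order_refl zero_le_power)
  have "(\<Sum>w\<in>W. real (i w) ^ 2) \<le> (\<Sum>w\<in>W. \<Delta> * real (i w) + (\<Sum>k\<in>{\<Delta><..m}. if k \<le> i w then 2 * real k else 0))"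
    by (rule sum_mono) (rule pt)
  also have "\<dots> = \<Delta> * (\<Sum>w\<in>W. real (i w)) + (\<Sum>k\<in>{\<Delta><..m}. \<Sum>w\<in>W. if k \<le> i w then 2 * real k else 0)"
    by (simp add: sum.distrib sum_distrib_left sum.swap[of _ _ W])
  also have "(\<Sum>k\<in>{\<Delta><..m}. \<Sum>w\<in>W. if k \<le> i w then 2 * real k else 0) \<le> (\<Sum>k\<in>{\<Delta><..m}. 2 * b * (1 / real k ^ 2))"
  proof (rule sum_mono)
    fix k assume k: "k \<in> {\<Delta><..m}"
    have "(\<Sum>w\<in>W. if k \<le> i w then 2 * real k else 0) = real (card {w \<in> W. k \<le> i w}) * (2 * real k)"
      using W by (simp add: sum.inter_filter[symmetric])
    also have "\<dots> \<le> 2 * b * (1 / real k ^ 2)"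
      using rich[of k] k \<Delta> by (simp add: field_simps power3_eq_cube power2_eq_square)
    finally show "(\<Sum>w\<in>W. if k \<le> i w then 2 * real k else 0) \<le> 2 * b * (1 / real k ^ 2)" .
  qed
  also have "\<dots> = 2 * b * (\<Sum>k\<in>{\<Delta><..m}. 1 / real k ^ 2)" by (simp add: sum_distrib_left)
  also have "\<dots> \<le> 2 * b * (1 / \<Delta>)"
    using b by (intro mult_left_mono sum_inverse_squares_tail \<Delta>) auto
  finally show ?thesis by simp
qed

text \<open>The fibre sizes sum to \<open>card \<Omega>\<close>, and their squares sum to the number
  of collisions.\<close>

lemma cauchy_schwarz_collisions:
  assumes "finite \<Omega>"
  shows "(card \<Omega>)\<^sup>2 \<le> card (f ` \<Omega>) * card {(u, v) \<in> \<Omega> \<times> \<Omega>. f u = f v}"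
proof -
  let ?c = "\<lambda>y. card {u \<in> \<Omega>. f u = y}"
  have 1: "card \<Omega> = (\<Sum>y\<in>f ` \<Omega>. ?c y)"
    using sum.image_gen[OF assms, of "\<lambda>_. 1::nat" f] by simp
  have "card {(u, v) \<in> \<Omega> \<times> \<Omega>. f u = f v} = card (SIGMA u:\<Omega>. {v \<in> \<Omega>. f v = f u})"
    by (rule arg_cong[where f = card]) auto
  also have "\<dots> = (\<Sum>u\<in>\<Omega>. ?c (f u))" using assms by simp
  also have "\<dots> = (\<Sum>y\<in>f ` \<Omega>. (?c y)\<^sup>2)"
    using sum.image_gen[OF assms, of "\<lambda>u. ?c (f u)" f] by (simp add: power2_eq_square)
  finally have 2: "card {(u, v) \<in> \<Omega> \<times> \<Omega>. f u = f v} = (\<Sum>y\<in>f ` \<Omega>. (?c y)\<^sup>2)" .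
  have "(\<Sum>y\<in>f ` \<Omega>. real (?c y))\<^sup>2 \<le> (\<Sum>y\<in>f ` \<Omega>. (real (?c y))\<^sup>2) * card (f ` \<Omega>)"
    by (rule sum_squared_le_sum_of_squares)
  then have "real ((card \<Omega>)\<^sup>2) \<le> real (card (f ` \<Omega>) * card {(u, v) \<in> \<Omega> \<times> \<Omega>. f u = f v})"
    unfolding 1 2 by (simp add: mult.commute)
  then show ?thesis by linarith
qed

definition dilate_sols :: "real set \<Rightarrow> real \<Rightarrow> nat" where
  "dilate_sols A q = card {((c, d), (c', d')). c \<in> A \<and> d \<in> A \<and> c' \<in> A \<and> d' \<in> A \<and> c + d = q * (c' + d')}"

text \<open>The equation reads \<open>c - q * c' = z\<close> and \<open>d - q * d' = - z\<close>, so
  \<open>(c', c)\<close> and \<open>(d', d)\<close> lie on lines of slope \<open>q\<close> with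
  opposite intercepts. The inequality of the means and the symmetry of \<open>Z\<close> turn the
  products of counts into squares.\<close>

lemma dilate_sols_le:
  assumes "finite A" and Z: "finite Z" "\<And>z. z \<in> Z \<Longrightarrow> - z \<in> Z" "\<And>c c'. c \<in> A \<Longrightarrow> c' \<in> A \<Longrightarrow> c - q * c' \<in> Z"
  shows "real (dilate_sols A q) \<le> (\<Sum>z\<in>Z. real (line_count A A q z) ^ 2)"
proof -
  let ?i = "\<lambda>z. {u \<in> A. q * u + z \<in> A}"
  have fin: "finite (?i z)" for z using assms by simp
  have "dilate_sols A q \<le> card (SIGMA z:Z. ?i z \<times> ?i (- z))"
    unfolding dilate_sols_def
  proof (rule card_inj_on_le[where f = "\<lambda>((c, d), (c', d')). (c - q * c', c', d')"])
    show "inj_on (\<lambda>((c, d), (c', d')). (c - q * c', c', d')) {((c, d), (c', d')). c \<in> A \<and> d \<in> A \<and> c' \<in> A \<and> d' \<in> A \<and> c + d = q * (c' + d')}"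
      by (auto simp: inj_on_def)
    show "(\<lambda>((c, d), (c', d')). (c - q * c', c', d')) ` {((c, d), (c', d')). c \<in> A \<and> d \<in> A \<and> c' \<in> A \<and> d' \<in> A \<and> c + d = q * (c' + d')}
       \<subseteq> (SIGMA z:Z. ?i z \<times> ?i (- z))"
    proof clarify
      fix c d c' d' assume *: "c \<in> A" "d \<in> A" "c' \<in> A" "d' \<in> A" "c + d = q * (c' + d')"
      then have "q * d' + - (c - q * c') = d" "q * c' + (c - q * c') = c" by (simp_all add: algebra_simps)
      then show "c - q * c' \<in> Z \<and> (c', d') \<in> ?i (c - q * c') \<times> ?i (- (c - q * c'))"
        unfolding mem_Times_iff fst_conv snd_conv mem_Collect_eq using * Z(3)[of c c'] by metis
    qed
  qed (intro finite_SigmaI finite_cartesian_product fin Z(1))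
  also have "\<dots> = (\<Sum>z\<in>Z. line_count A A q z * line_count A A q (- z))"
    unfolding line_count_def card_cartesian_product[symmetric]
    by (intro card_SigmaI ballI finite_cartesian_product fin Z(1))
  finally have "real (dilate_sols A q) \<le> (\<Sum>z\<in>Z. real (line_count A A q z) * real (line_count A A q (- z)))"
    by (metis (mono_tags, lifting) of_nat_le_iff of_nat_mult of_nat_sum sum.cong)
  also have "\<dots> \<le> (\<Sum>z\<in>Z. (real (line_count A A q z) ^ 2 + real (line_count A A q (- z)) ^ 2) / 2)"
  proof (rule sum_mono)
    fix z
    show "real (line_count A A q z) * real (line_count A A q (- z))
        \<le> (real (line_count A A q z) ^ 2 + real (line_count A A q (- z)) ^ 2) / 2"
      using sum_squares_bound[of "real (line_count A A q z)" "real (line_count A A q (- z))"] by simp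
  qed
  also have "\<dots> = ((\<Sum>z\<in>Z. real (line_count A A q z) ^ 2) + (\<Sum>z\<in>Z. real (line_count A A q (- z)) ^ 2)) / 2"
    by (simp add: sum.distrib sum_divide_distrib[symmetric])
  also have "(\<Sum>z\<in>Z. real (line_count A A q (- z)) ^ 2) = (\<Sum>z\<in>Z. real (line_count A A q z) ^ 2)"
    by (rule sum.reindex_bij_witness[of _ uminus uminus]) (use Z in auto)
  finally show ?thesis by simp
qed

lemma sum_line_count_le:
  assumes "finite A" "finite Z"
  shows "(\<Sum>z\<in>Z. line_count A A q z) \<le> (card A)\<^sup>2"
proof -
  have "(\<Sum>z\<in>Z. line_count A A q z) = card (SIGMA z:Z. {u \<in> A. q * u + z \<in> A})"
    using assms by (simp add: line_count_def)
  also have "\<dots> \<le> card (A \<times> A)"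
    by (rule card_inj_on_le[where f = "\<lambda>(z, u). (u, q * u + z)"]) (use assms in \<open>auto simp: inj_on_def\<close>)
  finally show ?thesis by (simp add: card_cartesian_product power2_eq_square)
qed

text \<open>The second moment over lines with slopes in \<open>S\<close> is split at
  \<open>\<Delta>\<close> near \<open>N / s\<close>, which balances
  \<open>\<Delta> * s\<^sup>2 * N\<^sup>2\<close> against \<open>N ^ 4 / \<Delta>\<close>. The size
  bound on \<open>S\<close> ensures \<open>N / s \<ge> 1\<close>. The constant is
  \<open>2 + 1024\<close>.\<close>

lemma sum_dilate_sols_le:
  fixes A S :: "real set"
  assumes A: "finite A" and S: "finite S" "0 \<notin> S" "card S \<le> (card A)\<^sup>2"
  shows "(\<Sum>q\<in>S. real (dilate_sols A q)) \<le> 1026 * real (card A) ^ 3 * sqrt (card S)"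
proof (cases "S = {}")
  case False
  define N s where "N = real (card A)" and "s = sqrt (card S)"
  have s: "s \<ge> 1" "s\<^sup>2 = card S" using False S by (auto simp: s_def Suc_le_eq card_gt_0_iff)
  have "s\<^sup>2 \<le> N\<^sup>2" using S(3) by (simp only: s N_def) (metis of_nat_le_iff of_nat_power)
  then have sN: "s \<le> N" by (rule power2_le_imp_le) (simp add: N_def)
  define \<Delta> where "\<Delta> = nat \<lceil>N / s\<rceil>"
  have Ns: "N / s \<ge> 1" using s sN by simp
  then have \<Delta>: "1 \<le> \<Delta>" "N / s \<le> \<Delta>" "\<Delta> \<le> 2 * (N / s)" unfolding \<Delta>_def by linarith+
  \<comment> \<open>One finite symmetric set of intercepts serves all slopes in
    \<open>S\<close>.\<close>
  define Z0 where "Z0 = (\<lambda>(q, c, c'). c - q * c') ` (S \<times> A \<times> A)"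
  define Z where "Z = Z0 \<union> uminus ` Z0"
  have Z: "finite Z" "\<And>z. z \<in> Z \<Longrightarrow> - z \<in> Z" using A S(1) unfolding Z_def Z0_def by (blast, force)
  have ZA: "c - q * c' \<in> Z" if "q \<in> S" "c \<in> A" "c' \<in> A" for q c c'
    using that by (force simp: Z_def Z0_def)
  let ?i = "\<lambda>(q, z). line_count A A q z"
  have "(\<Sum>q\<in>S. real (dilate_sols A q)) \<le> (\<Sum>q\<in>S. \<Sum>z\<in>Z. real (line_count A A q z) ^ 2)"
    by (rule sum_mono) (rule dilate_sols_le[OF A Z ZA])
  also have "\<dots> = (\<Sum>w\<in>S \<times> Z. real (?i w) ^ 2)"
    by (simp add: sum.cartesian_product split_beta)
  also have "\<dots> \<le> \<Delta> * (\<Sum>w\<in>S \<times> Z. real (?i w)) + 2 * (512 * N ^ 4) / \<Delta>"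
  proof (rule second_moment_from_rich[where m = "card A"])
    show "?i w \<le> card A" for w
      using card_mono[OF A] by (auto simp: line_count_def split: prod.splits)
    fix k :: nat assume "2 \<le> k"
    then show "real (card {w \<in> S \<times> Z. k \<le> ?i w}) * real k ^ 3 \<le> 512 * N ^ 4"
      using rich_lines_grid[OF A A _ \<open>2 \<le> k\<close>, of "{w \<in> S \<times> Z. k \<le> ?i w}"] S Z
      by (auto simp: N_def power_numeral_reduce algebra_simps)
  qed (use S Z \<Delta> in auto)
  finally have main: "(\<Sum>q\<in>S. real (dilate_sols A q)) \<le> \<dots>" .
  have "(\<Sum>w\<in>S \<times> Z. ?i w) = (\<Sum>q\<in>S. \<Sum>z\<in>Z. line_count A A q z)"
    by (simp add: sum.cartesian_product)
  also have "\<dots> \<le> card S * (card A)\<^sup>2"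
    using sum_bounded_above[of S "\<lambda>q. \<Sum>z\<in>Z. line_count A A q z" "(card A)\<^sup>2"] sum_line_count_le[OF A Z(1)] by simp
  finally have "real (\<Sum>w\<in>S \<times> Z. ?i w) \<le> real (card S * (card A)\<^sup>2)" by (rule of_nat_mono)
  then have "(\<Sum>w\<in>S \<times> Z. real (?i w)) \<le> s\<^sup>2 * N\<^sup>2" by (simp add: N_def s(2) split_beta)
  then have "real \<Delta> * (\<Sum>w\<in>S \<times> Z. real (?i w)) \<le> (2 * (N / s)) * (s\<^sup>2 * N\<^sup>2)"
    using \<Delta> Ns by (intro mult_mono) (auto intro: sum_nonneg)
  moreover have "2 * (512 * N ^ 4) / \<Delta> \<le> 2 * (512 * N ^ 4) / (N / s)"
    by (rule divide_left_mono[OF \<Delta>(2)]) (use \<Delta>(1) Ns in \<open>simp_all add: zero_less_mult_iff del: times_divide_eq_right\<close>)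
  ultimately have "(\<Sum>q\<in>S. real (dilate_sols A q)) \<le> 2 * (N / s) * (s\<^sup>2 * N\<^sup>2) + 2 * (512 * N ^ 4) / (N / s)"
    using main by linarith
  also have "\<dots> = 1026 * N ^ 3 * s"
    using s sN by (simp add: field_simps power_numeral_reduce)
  finally show ?thesis using \<Delta> by (simp add: N_def s_def)
qed simp

section \<open>Rich ratios\<close>

text \<open>The \<open>- 1\<close> is the largest ratio, which has no successor. Positivity of
  \<open>B\<close> makes the slopes of vector sums lie strictly between neighbouring ratios.\<close>

lemma solymosi_rich_ratios:
  fixes B S :: "real set"
  assumes B: "finite B" "\<And>b. b \<in> B \<Longrightarrow> 0 < b"
    and S: "finite S" "S \<noteq> {}" "\<And>q. q \<in> S \<Longrightarrow> t \<le> line_count B B q 0"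
  shows "(card S - 1) * t\<^sup>2 \<le> (card {b + c | b c. b \<in> B \<and> c \<in> B})\<^sup>2"
proof -
  define BB where "BB = {b + c | b c. b \<in> B \<and> c \<in> B}"
  have "BB = (\<lambda>(b, c). b + c) ` (B \<times> B)" by (auto simp: BB_def)
  then have finBB: "finite BB" using B by simp
  define U where "U q = {u \<in> B. q * u + 0 \<in> B}" for q
  have U: "finite (U q)" "U q \<subseteq> B" for q using B by (auto simp: U_def)
  have Ut: "t \<le> card (U q)" if "q \<in> S" for q using S(3)[OF that] by (simp add: U_def line_count_def)
  \<comment> \<open>Vector sums of points on two consecutive lines through the origin lie strictly between these
    lines, so different pairs of consecutive lines have disjoint sumsets.\<close>
  define S' where "S' = S - {Max S}"
  define nxt where "nxt q = Min {p \<in> S. q < p}" for q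
  have nxt: "nxt q \<in> S" "q < nxt q" "\<And>p. p \<in> S \<Longrightarrow> q < p \<Longrightarrow> nxt q \<le> p" if "q \<in> S'" for q
  proof -
    have "q < Max S" using that Max_ge[OF S(1), of q] by (simp add: S'_def)
    then have ne: "{p \<in> S. q < p} \<noteq> {}" "finite {p \<in> S. q < p}" using S(1) Max_in[OF S(1,2)] by auto
    from Min_in[OF ne(2,1)] show "nxt q \<in> S" "q < nxt q" by (auto simp: nxt_def)
    show "\<And>p. p \<in> S \<Longrightarrow> q < p \<Longrightarrow> nxt q \<le> p"
      using Min_le[OF ne(2)] by (auto simp: nxt_def)
  qed
  have slope: "q * (b + c) < q * b + nxt q * c" "q * b + nxt q * c < nxt q * (b + c)"
    if "q \<in> S'" "b \<in> U q" "c \<in> U (nxt q)" for q b c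
  proof -
    have "0 < b" "0 < c" "q < nxt q" using that U B nxt by blast+
    then show "q * (b + c) < q * b + nxt q * c" "q * b + nxt q * c < nxt q * (b + c)"
      by (auto simp: algebra_simps)
  qed
  have le: "p \<le> q" if "q \<in> S'" "b \<in> U q" "c \<in> U (nxt q)" "p \<in> S'" "b' \<in> U p" "c' \<in> U (nxt p)"
     "b + c = b' + c'" "q * b + nxt q * c = p * b' + nxt p * c'" for p q b c b' c'
  proof (rule ccontr)
    assume "\<not> p \<le> q"
    then have "nxt q \<le> p" using nxt that by (auto simp: S'_def)
    moreover have "0 < b + c" using that U B by (meson add_pos_pos subsetD)
    ultimately have "nxt q * (b + c) \<le> p * (b + c)" by simp
    then show False using slope[OF that(1-3)] slope[OF that(4-6)] that(7,8) by simp
  qed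
  have "(card S - 1) * t\<^sup>2 = card S' * (t * t)"
    using S by (simp add: S'_def power2_eq_square card_Diff_singleton)
  also have "\<dots> \<le> (\<Sum>q\<in>S'. card (U q \<times> U (nxt q)))"
  proof -
    have "t * t \<le> card (U q \<times> U (nxt q))" if "q \<in> S'" for q
      unfolding card_cartesian_product
      by (rule mult_mono) (use Ut nxt that in \<open>auto simp: S'_def\<close>)
    then show ?thesis using sum_bounded_below[of S' "t * t"] by auto
  qed
  also have "\<dots> = card (SIGMA q:S'. U q \<times> U (nxt q))"
    using S U by (simp add: S'_def)
  also have "\<dots> \<le> card (BB \<times> BB)"
  proof (rule card_inj_on_le[where f = "\<lambda>(q, b, c). (b + c, q * b + nxt q * c)"])
    show "inj_on (\<lambda>(q, b, c). (b + c, q * b + nxt q * c)) (SIGMA q:S'. U q \<times> U (nxt q))"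
    proof (rule inj_onI)
      fix w w' assume w: "w \<in> (SIGMA q:S'. U q \<times> U (nxt q))" "w' \<in> (SIGMA q:S'. U q \<times> U (nxt q))"
        "(\<lambda>(q, b, c). (b + c, q * b + nxt q * c)) w = (\<lambda>(q, b, c). (b + c, q * b + nxt q * c)) w'"
      obtain q b c p b' c' where ww: "w = (q, b, c)" "w' = (p, b', c')" by (metis prod_cases3)
      have q: "q \<in> S'" "b \<in> U q" "c \<in> U (nxt q)" and p: "p \<in> S'" "b' \<in> U p" "c' \<in> U (nxt p)"
        and eq: "b + c = b' + c'" "q * b + nxt q * c = p * b' + nxt p * c'"
        using w unfolding ww by auto
      have "q = p" using le[OF q p eq] le[OF p q eq[symmetric]] by simp
      \<comment> \<open>For fixed \<open>q\<close> the map is linear in \<open>(b, c)\<close> with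
        determinant \<open>nxt q - q > 0\<close>.\<close>
      have "(nxt q - q) * (c - c') = (q * b + nxt q * c) - (q * b' + nxt q * c') - q * ((b + c) - (b' + c'))"
        by (simp add: algebra_simps)
      also have "\<dots> = 0" using eq \<open>q = p\<close> by simp
      finally have "(nxt q - q) * (c - c') = 0" .
      then have "c = c'" using nxt[OF q(1)] by simp
      then show "w = w'" unfolding ww using \<open>q = p\<close> eq by simp
    qed
    show "(\<lambda>(q, b, c). (b + c, q * b + nxt q * c)) ` (SIGMA q:S'. U q \<times> U (nxt q)) \<subseteq> BB \<times> BB"
    proof (rule image_subsetI)
      fix w assume "w \<in> (SIGMA q:S'. U q \<times> U (nxt q))"
      then obtain q b c where w: "w = (q, b, c)" and "b \<in> U q" "c \<in> U (nxt q)" by auto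
      then have "b \<in> B" "c \<in> B" "q * b \<in> B" "nxt q * c \<in> B" by (auto simp: U_def)
      then show "(\<lambda>(q, b, c). (b + c, q * b + nxt q * c)) w \<in> BB \<times> BB"
        by (auto simp: BB_def w)
    qed
  qed (use finBB in auto)
  finally show ?thesis by (simp add: BB_def card_cartesian_product power2_eq_square)
qed

section \<open>Representation counts of ratios and collisions of products\<close>

definition ratio_set :: "real set \<Rightarrow> real set" where
  "ratio_set B = (\<lambda>(b, b'). b / b') ` (B \<times> B)"

text \<open>The set \<open>S t\<close> of the overview. Staying inside \<open>ratio_set B\<close>
  keeps it finite for finite \<open>B\<close>, also at \<open>t = 0\<close>.\<close>

definition rich_ratios :: "real set \<Rightarrow> nat \<Rightarrow> real set" where
  "rich_ratios B t = {q \<in> ratio_set B. t \<le> line_count B B q 0}"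

lemma finite_rich_ratios: "finite B \<Longrightarrow> finite (rich_ratios B t)"
  by (simp add: rich_ratios_def ratio_set_def)

lemma card_ratio_fibre:
  assumes "0 \<notin> B"
  shows "card {p \<in> B \<times> B. (case p of (b, b') \<Rightarrow> b / b') = q} = line_count B B q 0"
proof -
  have "bij_betw (\<lambda>u. (q * u, u)) {u \<in> B. q * u + 0 \<in> B} {p \<in> B \<times> B. (case p of (b, b') \<Rightarrow> b / b') = q}"
    by (rule bij_betw_byWitness[where f' = snd]) (use assms in \<open>auto simp: field_simps\<close>)
  then show ?thesis unfolding line_count_def by (rule bij_betw_same_card[symmetric])
qed

text \<open>A ratio with \<open>r\<close> representations occurs \<open>r\<close> times on the left,
  and belongs to \<open>rich_ratios B t\<close> for exactly \<open>r\<close> values of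
  \<open>t\<close> on the right.\<close>

lemma sum_over_ratios:
  fixes g :: "real \<Rightarrow> real"
  assumes B: "finite B" "0 \<notin> B"
  shows "(\<Sum>(b, b')\<in>B \<times> B. g (b / b')) = (\<Sum>t\<in>{1..card B}. \<Sum>q\<in>rich_ratios B t. g q)"
proof -
  let ?r = "\<lambda>q. line_count B B q 0"
  have finQ: "finite (ratio_set B)" using B by (simp add: ratio_set_def)
  have le: "?r q \<le> card B" for q unfolding line_count_def by (rule card_mono) (use B in auto)
  have "(\<Sum>(b, b')\<in>B \<times> B. g (b / b')) = (\<Sum>p\<in>B \<times> B. g (case p of (b, b') \<Rightarrow> b / b'))"
    by (rule sum.cong) auto
  also have "\<dots> = (\<Sum>q\<in>ratio_set B. \<Sum>p\<in>{p \<in> B \<times> B. (case p of (b, b') \<Rightarrow> b / b') = q}. g (case p of (b, b') \<Rightarrow> b / b'))"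
    unfolding ratio_set_def by (rule sum.image_gen) (use B in simp)
  also have "\<dots> = (\<Sum>q\<in>ratio_set B. real (?r q) * g q)"
    using card_ratio_fibre[OF B(2)] by (intro sum.cong) simp_all
  also have "\<dots> = (\<Sum>q\<in>ratio_set B. \<Sum>t\<in>{1..card B}. if t \<le> ?r q then g q else 0)"
  proof (rule sum.cong)
    fix q
    have "{t \<in> {1..card B}. t \<le> ?r q} = {1..?r q}" using le[of q] by auto
    then show "real (?r q) * g q = (\<Sum>t\<in>{1..card B}. if t \<le> ?r q then g q else 0)"
      by (simp add: sum.inter_filter[symmetric])
  qed simp
  also have "\<dots> = (\<Sum>t\<in>{1..card B}. \<Sum>q\<in>ratio_set B. if t \<le> ?r q then g q else 0)"
    by (rule sum.swap)
  also have "\<dots> = (\<Sum>t\<in>{1..card B}. \<Sum>q\<in>rich_ratios B t. g q)"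
    unfolding rich_ratios_def using finQ by (simp add: sum.inter_filter)
  finally show ?thesis .
qed

lemma rich_ratios_first_moment:
  assumes B: "finite B" "0 \<notin> B"
  shows "t * card (rich_ratios B t) \<le> (card B)\<^sup>2"
proof -
  let ?S = "rich_ratios B t"
  have "t * card ?S \<le> (\<Sum>q\<in>?S. line_count B B q 0)"
    using sum_bounded_below[of ?S t "\<lambda>q. line_count B B q 0"] by (simp add: rich_ratios_def mult.commute)
  also have "\<dots> = card (SIGMA q:?S. {u \<in> B. q * u + 0 \<in> B})"
    using B finite_rich_ratios by (simp add: line_count_def)
  also have "\<dots> \<le> card (B \<times> B)"
    by (rule card_inj_on_le[where f = "\<lambda>(q, u). (u, q * u)"]) (use B in \<open>auto simp: inj_on_def\<close>)
  finally show ?thesis by (simp add: card_cartesian_product power2_eq_square)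
qed

lemma collisions_product_set:
  assumes A: "finite A" and B: "finite B" "0 \<notin> (B :: real set)"
  shows "(card B * (card A)\<^sup>2)\<^sup>2 \<le> card ((\<lambda>(b, c, d). b * (c + d)) ` (B \<times> A \<times> A)) *
           (\<Sum>(b, b')\<in>B \<times> B. dilate_sols A (b / b'))"
proof -
  let ?f = "\<lambda>(b, c, d). b * (c + d)" and ?\<Omega> = "B \<times> A \<times> A"
  define T where "T q = {((c, d), (c', d')). c \<in> A \<and> d \<in> A \<and> c' \<in> A \<and> d' \<in> A \<and> c + d = q * (c' + d')}" for q
  have fin: "finite (T q)" for q
    by (rule finite_subset[of _ "(A \<times> A) \<times> (A \<times> A)"]) (use A in \<open>auto simp: T_def\<close>)
  have "card {(u, v) \<in> ?\<Omega> \<times> ?\<Omega>. ?f u = ?f v} \<le> card (SIGMA p:B \<times> B. T (fst p / snd p))"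
  \<comment> \<open>A collision \<open>b * (c + d) = b' * (c' + d')\<close> is a dilate solution for
    the ratio \<open>b' / b\<close>; hence the swapped order.\<close>
  proof (rule card_inj_on_le[where f = "\<lambda>((b, c, d), (b', c', d')). ((b', b), ((c, d), (c', d')))"])
    show "inj_on (\<lambda>((b, c, d), (b', c', d')). ((b', b), ((c, d), (c', d')))) {(u, v) \<in> ?\<Omega> \<times> ?\<Omega>. ?f u = ?f v}"
      by (auto simp: inj_on_def)
    show "(\<lambda>((b, c, d), (b', c', d')). ((b', b), ((c, d), (c', d')))) ` {(u, v) \<in> ?\<Omega> \<times> ?\<Omega>. ?f u = ?f v}
       \<subseteq> (SIGMA p:B \<times> B. T (fst p / snd p))"
      using B by (auto simp: T_def) (metis nonzero_mult_div_cancel_left times_divide_eq_left)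
    show "finite (SIGMA p:B \<times> B. T (fst p / snd p))" using B fin by simp
  qed
  also have "\<dots> = (\<Sum>(b, b')\<in>B \<times> B. dilate_sols A (b / b'))"
  proof -
    have "dilate_sols A q = card (T q)" for q by (simp add: dilate_sols_def T_def)
    then show ?thesis using B fin by (simp add: split_beta)
  qed
  finally have le: "card {(u, v) \<in> ?\<Omega> \<times> ?\<Omega>. ?f u = ?f v} \<le> (\<Sum>(b, b')\<in>B \<times> B. dilate_sols A (b / b'))" .
  have "(card B * (card A)\<^sup>2)\<^sup>2 = (card ?\<Omega>)\<^sup>2" by (simp add: card_cartesian_product power2_eq_square)
  also have "\<dots> \<le> card (?f ` ?\<Omega>) * card {(u, v) \<in> ?\<Omega> \<times> ?\<Omega>. ?f u = ?f v}"
    by (rule cauchy_schwarz_collisions) (use A B in simp)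
  also have "\<dots> \<le> card (?f ` ?\<Omega>) * (\<Sum>(b, b')\<in>B \<times> B. dilate_sols A (b / b'))"
    using le by (rule mult_left_mono) simp
  finally show ?thesis .
qed

section \<open>Reflection and shifts of the product set\<close>

lemma finite_sumprod_set: "finite A \<Longrightarrow> finite (sumprod_set A x)"
proof -
  assume "finite A"
  have "sumprod_set A x = (\<lambda>(b, c, d). (b + c) * (d + x)) ` (A \<times> A \<times> A)"
    by (force simp: sumprod_set_def)
  then show ?thesis using \<open>finite A\<close> by simp
qed

lemma sumprod_set_neg: "sumprod_set (uminus ` A) (- x) = sumprod_set A x"
proof (intro equalityI subsetI)
  fix z assume "z \<in> sumprod_set (uminus ` A) (- x)"
  then obtain b c d where "b \<in> A" "c \<in> A" "d \<in> A" "z = (- b + - c) * (- d + - x)"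
    by (auto simp: sumprod_set_def)
  moreover have "(- b + - c) * (- d + - x) = (b + c) * (d + x)" by (simp add: algebra_simps)
  ultimately show "z \<in> sumprod_set A x" unfolding sumprod_set_def by blast
next
  fix z assume "z \<in> sumprod_set A x"
  then obtain b c d where "b \<in> A" "c \<in> A" "d \<in> A" "z = (b + c) * (d + x)"
    by (auto simp: sumprod_set_def)
  then have "- b \<in> uminus ` A" "- c \<in> uminus ` A" "- d \<in> uminus ` A"
      "z = (- b + - c) * (- d + - x)"
    by (simp_all add: algebra_simps)
  then show "z \<in> sumprod_set (uminus ` A) (- x)" unfolding sumprod_set_def by blast
qed

text \<open>If \<open>u\<close> and \<open>q * u = a' + x\<close> lie in \<open>B\<close>, then
  \<open>d * (q * u + y - x) = d * (a' + y)\<close> lies in \<open>sumprod_set A y\<close>. As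
  \<open>x \<noteq> y\<close>, the intercept recovers \<open>d\<close>, and then the slope recovers
  \<open>q\<close> because \<open>d \<noteq> 0\<close>.\<close>

lemma rich_ratios_shift:
  fixes A :: "real set"
  assumes A: "finite A" and xy: "x \<noteq> y" and B: "B \<subseteq> (\<lambda>a. a + x) ` A" "0 \<notin> B" and t: "2 \<le> t"
  shows "real (card (rich_ratios B t)) * real t ^ 3 * real (card ({a + a' | a a'. a \<in> A \<and> a' \<in> A} - {0}))
          \<le> 512 * real (card A) ^ 2 * real (card (sumprod_set A y)) ^ 2"
proof -
  define D where "D = {a + a' | a a'. a \<in> A \<and> a' \<in> A} - {0}"
  let ?S = "rich_ratios B t" and ?Y = "sumprod_set A y"
  have finB: "finite B" using A B finite_subset by blast
  have "{a + a' | a a'. a \<in> A \<and> a' \<in> A} = (\<lambda>(a, a'). a + a') ` (A \<times> A)" by auto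
  then have finD: "finite D" using A by (simp add: D_def)
  have S0: "q \<noteq> 0" if "q \<in> ?S" for q using that B by (auto simp: rich_ratios_def ratio_set_def)
  define L where "L = (\<lambda>(q, d). (d * q, d * (y - x))) ` (?S \<times> D)"
  have "inj_on (\<lambda>(q, d). (d * q, d * (y - x))) (?S \<times> D)"
    using xy by (auto simp: inj_on_def D_def)
  then have cardL: "card L = card ?S * card D"
    unfolding L_def by (simp add: card_image card_cartesian_product)
  have "real (card L) * real t ^ 3 \<le> 512 * real (card B)^2 * real (card ?Y)^2"
  proof (rule rich_lines_grid[OF finB finite_sumprod_set[OF A] _ t])
    show "finite L" using finite_rich_ratios[OF finB] finD by (simp add: L_def)
    fix a b assume "(a, b) \<in> L"
    then obtain q d where q: "q \<in> ?S" and d: "d \<in> D" and ab: "a = d * q" "b = d * (y - x)" by (auto simp: L_def)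
    have "t \<le> line_count B B q 0" using q by (simp add: rich_ratios_def)
    also have "\<dots> \<le> line_count B ?Y a b"
      unfolding line_count_def
    proof (rule card_mono)
      show "{u \<in> B. q * u + 0 \<in> B} \<subseteq> {u \<in> B. a * u + b \<in> ?Y}"
      proof clarify
        fix u assume "u \<in> B" "q * u + 0 \<in> B"
        then obtain a' where a': "a' \<in> A" "q * u = a' + x" using B by auto
        have "a * u + b = d * (q * u + (y - x))" by (simp add: ab algebra_simps)
        also have "\<dots> = d * (a' + y)" by (simp add: a')
        also have "\<dots> \<in> ?Y" using d a' by (auto simp: sumprod_set_def D_def)
        finally show "a * u + b \<in> ?Y" .
      qed
    qed (use finB in simp)
    finally show "a \<noteq> 0 \<and> t \<le> line_count B ?Y a b" using d S0[OF q] ab by (simp add: D_def)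
  qed
  also have "\<dots> \<le> 512 * real (card A)^2 * real (card ?Y)^2"
  proof -
    have "card B \<le> card A" using A B surj_card_le by blast
    then show ?thesis by (intro mult_right_mono mult_left_mono power_mono) auto
  qed
  finally show ?thesis by (simp add: cardL D_def mult_ac)
qed

section \<open>Elementary summation estimates\<close>

lemma sum_inverse_sqrt_le: "(\<Sum>t\<in>{1..n}. 1 / sqrt (real t)) \<le> 2 * sqrt n"
proof (induction n)
  case (Suc n)
  define a b where "a = sqrt n" and "b = sqrt (Suc n)"
  have b: "0 < b" and sq: "b * b = a * a + 1" by (simp_all add: a_def b_def)
  have "0 \<le> (b - a) * (b - a)" by simp
  then have "1 \<le> 2 * (b - a) * b" using sq by (simp add: algebra_simps)
  then have "1 / b \<le> 2 * (b - a)" using b by (subst pos_divide_le_eq)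
  then have "1 / sqrt (Suc n) \<le> 2 * (sqrt (Suc n) - sqrt n)" by (simp only: a_def b_def)
  then show ?case using Suc by simp
qed simp

text \<open>Telescoping: for \<open>a = sqrt (t - 1)\<close> and \<open>b = sqrt t\<close> one has
  \<open>1 / b ^ 3 \<le> 2 / a - 2 / b\<close>. The induction carries the extra term
  \<open>- 2 / sqrt n\<close>.\<close>

lemma sum_inverse_sqrt3_tail:
  assumes "1 \<le> (\<Delta>::nat)"
  shows "(\<Sum>t\<in>{\<Delta><..n}. 1 / (real t * sqrt t)) \<le> 2 / sqrt \<Delta>"
proof (cases "\<Delta> \<le> n")
  case True
  have "(\<Sum>t\<in>{\<Delta><..n}. 1 / (real t * sqrt t)) \<le> 2 / sqrt \<Delta> - 2 / sqrt n"
    using True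
  proof (induction n rule: dec_induct)
    case (step n)
    define a b where "a = sqrt n" and "b = sqrt (Suc n)"
    have "0 < n" using step(1) assms by linarith
    then have a: "0 < a" and b: "a < b" by (simp_all add: a_def b_def)
    have sq: "b * b = a * a + 1" by (simp add: a_def b_def)
    have "0 \<le> (b - a) * (b - a)" by simp
    then have "1 \<le> 2 * (b - a) * b" using sq by (simp add: algebra_simps)
    then have "a * 1 \<le> b * (2 * (b - a) * b)"
      using a b by (intro mult_mono) simp_all
    then have "1 / (b * b * b) \<le> 2 * (b - a) / (a * b)"
      using a b by (simp add: divide_simps mult_ac)
    also have "\<dots> = 2 / a - 2 / b"
      using a b by (simp add: divide_simps right_diff_distrib)
    finally have "1 / (Suc n * sqrt (Suc n)) \<le> 2 / sqrt n - 2 / sqrt (Suc n)"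
      by (simp add: a_def b_def)
    moreover have "{\<Delta><..Suc n} = insert (Suc n) {\<Delta><..n}" using step by auto
    ultimately show ?case using step by simp
  qed simp
  then show ?thesis by (smt (verit) of_nat_0_le_iff real_sqrt_ge_zero zero_le_divide_iff)
qed simp

text \<open>The first-moment bound gives \<open>N / sqrt t\<close>, the third-moment bound
  \<open>32 * N * u / (t * sqrt t)\<close>. Cutting near \<open>t = u\<close> makes both sums of
  order \<open>N * sqrt u\<close>; the constant is \<open>3 + 64\<close>.\<close>

lemma sum_sqrt_split:
  fixes s :: "nat \<Rightarrow> real"
  assumes s: "\<And>t. 0 \<le> s t" and N: "0 \<le> N" and u: "1 \<le> u"
    and 1: "\<And>t. t * s t \<le> N\<^sup>2" and 3: "\<And>t. 2 \<le> t \<Longrightarrow> real t ^ 3 * s t \<le> 1024 * N\<^sup>2 * u\<^sup>2"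
  shows "(\<Sum>t\<in>{1..n}. sqrt (s t)) \<le> 67 * N * sqrt u"
proof -
  define \<Delta> where "\<Delta> = nat \<lceil>u\<rceil>"
  have \<Delta>: "1 \<le> \<Delta>" "u \<le> \<Delta>" "\<Delta> \<le> 2 * u" unfolding \<Delta>_def using u by linarith+
  have pt1: "sqrt (s t) \<le> N * (1 / sqrt (real t))" if "1 \<le> t" for t
  proof -
    have "sqrt (t * s t) \<le> sqrt (N\<^sup>2)" using 1 by (rule real_sqrt_le_mono)
    then show ?thesis using that N by (simp add: real_sqrt_mult field_simps)
  qed
  have pt3: "sqrt (s t) \<le> 32 * N * u * (1 / (real t * sqrt t))" if "2 \<le> t" for t
  proof -
    have "sqrt (real t ^ 3 * s t) \<le> sqrt ((32 * N * u)\<^sup>2)"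
      using 3[OF that] by (intro real_sqrt_le_mono) (simp add: power_mult_distrib)
    moreover have "sqrt (real t ^ 3) = t * sqrt t"
      by (simp add: power3_eq_cube real_sqrt_mult)
    ultimately show ?thesis using that N u by (simp add: real_sqrt_mult field_simps)
  qed
  have "(\<Sum>t\<in>{1..n}. sqrt (s t)) \<le> (\<Sum>t\<in>{1..\<Delta>} \<union> {\<Delta><..n}. sqrt (s t))"
    by (rule sum_mono2) (use s in auto)
  also have "\<dots> = (\<Sum>t\<in>{1..\<Delta>}. sqrt (s t)) + (\<Sum>t\<in>{\<Delta><..n}. sqrt (s t))"
    by (rule sum.union_disjoint) auto
  also have "\<dots> \<le> (\<Sum>t\<in>{1..\<Delta>}. N * (1 / sqrt (real t))) + (\<Sum>t\<in>{\<Delta><..n}. 32 * N * u * (1 / (real t * sqrt t)))"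
    using \<Delta>(1) pt1 pt3 by (intro add_mono sum_mono) auto
  also have "\<dots> = N * (\<Sum>t\<in>{1..\<Delta>}. 1 / sqrt (real t)) + 32 * N * u * (\<Sum>t\<in>{\<Delta><..n}. 1 / (t * sqrt t))"
    by (simp only: sum_distrib_left)
  also have "\<dots> \<le> N * (2 * sqrt (real \<Delta>)) + 32 * N * u * (2 / sqrt (real \<Delta>))"
    using N u \<Delta> by (intro add_mono mult_left_mono sum_inverse_sqrt_le sum_inverse_sqrt3_tail) auto
  also have "\<dots> \<le> N * (3 * sqrt u) + 32 * N * u * (2 / sqrt u)"
  proof (intro add_mono mult_left_mono)
    \<comment> \<open>Here \<open>4 * \<Delta> \<le> 8 * u \<le> 9 * u\<close>.\<close>
    have "2 * sqrt (real \<Delta>) \<le> sqrt (9 * u)"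
      using \<Delta> u by (intro real_le_rsqrt) (simp add: power_mult_distrib)
    then show "2 * sqrt (real \<Delta>) \<le> 3 * sqrt u" by (simp add: real_sqrt_mult)
    show "2 / sqrt (real \<Delta>) \<le> 2 / sqrt u" using \<Delta> u by (intro divide_left_mono) auto
  qed (use N u in auto)
  also have "\<dots> = 67 * N * sqrt u"
  proof -
    have "32 * N * u * (2 / sqrt u) = 64 * N * (u / sqrt u)" by simp
    also have "u / sqrt u = sqrt u" using u by (simp add: real_div_sqrt)
    finally show ?thesis by simp
  qed
  finally show ?thesis .
qed

lemma harm_le_log:
  assumes "n \<le> N" "2 \<le> N"
  shows "(harm n :: real) \<le> 2 * log 2 (real N)"
proof -
  have L1: "1 \<le> log 2 (real N)" using assms by (simp add: le_log_iff)
  have "ln (real N) = ln 2 * log 2 (real N)" by (simp add: log_def)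
  also have "\<dots> \<le> 1 * log 2 (real N)" using L1 ln_2_less_1 by (intro mult_right_mono) auto
  finally have ln_le: "ln (real N) \<le> log 2 (real N)" by simp
  have "(harm n :: real) \<le> harm N" using assms(1) by (rule harm_mono)
  \<comment> \<open>The sequence \<open>harm n - ln n\<close> decreases from its value 1 at
    \<open>n = 1\<close>.\<close>
  also have "\<dots> \<le> 1 + ln (real N)"
    using euler_mascheroni_sequence_decreasing[of 1 N] assms(2) by (simp add: harm_expand)
  finally show ?thesis using L1 ln_le by linarith
qed

section \<open>Two shifts\<close>

text \<open>In the constant, \<open>16416 = 16 * 1026\<close> comes from
  \<open>N \<le> 4 * n\<close> and the dilate bound, and 67 and 4 from the two upper bounds on
  \<open>\<sigma>\<close>.\<close>

lemma two_shifts_bound_pos: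
  fixes A B :: "real set" and x y P :: real
  assumes A: "finite A" and A2: "2 \<le> card A" and xy: "x \<noteq> y"
    and B: "B \<subseteq> (\<lambda>a. a + x) ` A" "\<And>b. b \<in> B \<Longrightarrow> 0 < b" "card A \<le> 4 * card B"
    and P: "real (card (sumprod_set A x)) \<le> P" "real (card (sumprod_set A y)) \<le> P"
  shows "real (card A) ^ 11 \<le> 16416 ^ 5 * 67 ^ 4 * 4 * P ^ 7 * log 2 (card A)"
proof -
  define AA where "AA = {a + a' | a a'. a \<in> A \<and> a' \<in> A}"
  define N M n where "N = real (card A)" and "M = real (card AA)" and "n = real (card B)"
  define s where "s t = real (card (rich_ratios B t))" for t
  define \<sigma> where "\<sigma> = (\<Sum>t\<in>{1..card B}. sqrt (s t))"
  \<comment> \<open>Normalises the third-moment bound \<open>N\<^sup>2 * P\<^sup>2 / M\<close> to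
    \<open>N\<^sup>2 * u\<^sup>2\<close>.\<close>
  define u where "u = P / sqrt M"
  define L where "L = log 2 N"
  have finB: "finite B" using A B(1) finite_subset by blast
  have B0: "0 \<notin> B" using B(2) by force
  have "AA = (\<lambda>(a, a'). a + a') ` (A \<times> A)" by (auto simp: AA_def)
  then have finAA: "finite AA" using A by simp
  have N2: "2 \<le> N" using A2 by (simp add: N_def)
  have BA: "card B \<le> card A" using A B surj_card_le by blast
  have nN: "N \<le> 4 * n" "n \<le> N" using B(3) BA by (simp_all add: N_def n_def)
  obtain a0 where a0: "a0 \<in> A" using A2 by fastforce
  have "card A \<le> card AA"
    by (rule card_inj_on_le[where f = "(+) a0"]) (use a0 finAA in \<open>auto simp: AA_def\<close>)
  then have NM: "N \<le> M" by (simp add: N_def M_def)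
  have "B \<noteq> {}" using nN N2 by (auto simp: n_def)
  then obtain b a where ba: "b \<in> B" "a \<in> A" "b = a + x" using B(1) by blast
  \<comment> \<open>Dilation by a single \<open>b \<in> B\<close> embeds \<open>AA\<close>. The
    resulting \<open>M \<le> P\<close> gives \<open>1 \<le> u\<close>.\<close>
  have "card AA \<le> card (sumprod_set A x)"
  proof (rule card_inj_on_le[where f = "\<lambda>v. v * b"])
    show "inj_on (\<lambda>v. v * b) AA" using B(2)[OF ba(1)] by (auto simp: inj_on_def)
    show "(\<lambda>v. v * b) ` AA \<subseteq> sumprod_set A x" using ba by (auto simp: AA_def sumprod_set_def)
  qed (rule finite_sumprod_set[OF A])
  then have MP: "M \<le> P" using P(1) by (simp add: M_def)
  have u1: "1 \<le> u"
  proof -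
    have "sqrt M \<le> M" using NM N2 by (intro real_le_lsqrt) (simp_all add: power2_eq_square)
    then show ?thesis using MP NM N2 by (simp add: u_def)
  qed
  have L1: "1 \<le> L" using N2 by (simp add: L_def le_log_iff)
  have s0: "0 \<le> s t" for t by (simp add: s_def)
  have s1: "t * s t \<le> N\<^sup>2" for t :: nat
  proof -
    have "real (t * card (rich_ratios B t)) \<le> real ((card B)\<^sup>2)"
      using rich_ratios_first_moment[OF finB B0] by (rule of_nat_mono)
    then have "t * s t \<le> n\<^sup>2" by (simp add: s_def n_def)
    also have "\<dots> \<le> N\<^sup>2" using nN N2 by (intro power_mono) auto
    finally show ?thesis .
  qed
  have s2: "(t * sqrt (s t))\<^sup>2 \<le> 2 * M\<^sup>2" for t :: nat
  proof -
    let ?BB = "{b + c | b c. b \<in> B \<and> c \<in> B}"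
    have tN: "t \<le> N" if "q \<in> rich_ratios B t" for q
    proof -
      have "card {v \<in> B. q * v + 0 \<in> B} \<le> card B" by (rule card_mono) (use finB in auto)
      then show ?thesis using that nN by (simp add: rich_ratios_def line_count_def N_def n_def)
    qed
    have BBAA: "card ?BB \<le> card AA"
    proof (rule card_inj_on_le[where f = "\<lambda>v. v - 2 * x"])
      show "(\<lambda>v. v - 2 * x) ` ?BB \<subseteq> AA"
      proof clarify
        fix v b c assume "b \<in> B" "c \<in> B"
        then obtain a a' where "a \<in> A" "a' \<in> A" "b = a + x" "c = a' + x" using B(1) by blast
        then have "b + c - 2 * x = a + a'" "a \<in> A" "a' \<in> A" by simp_all
        then show "b + c - 2 * x \<in> AA" unfolding AA_def by blast
      qed
    qed (use finAA in \<open>auto simp: inj_on_def\<close>)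
    have "s t * (real t)\<^sup>2 \<le> 2 * M\<^sup>2"
    proof (cases "rich_ratios B t = {}")
      case False
      then obtain q where "q \<in> rich_ratios B t" by auto
      \<comment> \<open>Makes up for the one ratio lost in Solymosi's bound, whence
        \<open>2 * M\<^sup>2\<close>.\<close>
      then have tM: "(real t)\<^sup>2 \<le> M\<^sup>2" using tN NM by (intro power_mono) force+
      have "(card (rich_ratios B t) - 1) * t\<^sup>2 \<le> (card ?BB)\<^sup>2"
        by (rule solymosi_rich_ratios[OF finB B(2) finite_rich_ratios[OF finB] False])
          (auto simp: rich_ratios_def)
      also have "\<dots> \<le> (card AA)\<^sup>2" using BBAA by (rule power_mono) simp
      finally have "real ((card (rich_ratios B t) - 1) * t\<^sup>2) \<le> real ((card AA)\<^sup>2)" by (rule of_nat_mono)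
      moreover have "real (card (rich_ratios B t) - 1) = s t - 1"
        using False finite_rich_ratios[OF finB, of t] by (simp add: s_def of_nat_diff Suc_le_eq card_gt_0_iff)
      ultimately have "(s t - 1) * t\<^sup>2 \<le> M\<^sup>2" by (simp add: M_def)
      then show ?thesis using tM by (simp add: algebra_simps)
    qed (simp add: s_def)
    then show ?thesis by (simp add: power_mult_distrib s0 mult.commute)
  qed
  have s3: "real t ^ 3 * s t \<le> 1024 * N\<^sup>2 * u\<^sup>2" if "2 \<le> t" for t :: nat
  proof -
    \<comment> \<open>Removing 0 costs at most half of \<open>AA\<close> because
      \<open>M \<ge> 2\<close>; this doubles 512 to 1024.\<close>
    have "M / 2 \<le> real (card (AA - {0}))"
    proof -
      have "card AA - 1 \<le> card (AA - {0})" using finAA by (simp add: card_Diff_singleton_if)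
      then show ?thesis using NM N2 unfolding M_def by linarith
    qed
    then have "s t * t ^ 3 * (M / 2) \<le> s t * t ^ 3 * real (card (AA - {0}))"
      using s0 by (intro mult_left_mono) auto
    also have "\<dots> \<le> 512 * N\<^sup>2 * real (card (sumprod_set A y)) ^ 2"
      using rich_ratios_shift[OF A xy B(1) B0 that] by (simp add: s_def N_def AA_def)
    also have "\<dots> \<le> 512 * N\<^sup>2 * P\<^sup>2" using P(2) by (intro mult_left_mono power_mono) auto
    finally have "s t * t ^ 3 * M \<le> 1024 * N\<^sup>2 * P\<^sup>2" by simp
    then have "s t * t ^ 3 \<le> 1024 * N\<^sup>2 * P\<^sup>2 / M" using NM N2 by (simp add: pos_le_divide_eq)
    also have "\<dots> = 1024 * N\<^sup>2 * u\<^sup>2" using NM N2 by (simp add: u_def power_divide)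
    finally show ?thesis by (simp add: mult.commute)
  qed
  have \<sigma>0: "0 \<le> \<sigma>" unfolding \<sigma>_def by (intro sum_nonneg) (simp add: s0)
  have \<sigma>1: "\<sigma> \<le> 67 * N * sqrt u"
    unfolding \<sigma>_def by (rule sum_sqrt_split[OF s0 _ u1 s1 s3]) (use N2 in auto)
  have \<sigma>2: "\<sigma> \<le> 4 * M * L"
  proof -
    have "\<sigma> \<le> (\<Sum>t\<in>{1..card B}. 2 * M * inverse (of_nat t))"
      unfolding \<sigma>_def
    proof (rule sum_mono)
      fix t assume t: "t \<in> {1..card B}"
      have "2 * M\<^sup>2 \<le> (2 * M)\<^sup>2" by (simp add: power_mult_distrib)
      with s2[of t] have "(t * sqrt (s t))\<^sup>2 \<le> (2 * M)\<^sup>2" by (rule order_trans)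
      then have "t * sqrt (s t) \<le> 2 * M" by (rule power2_le_imp_le) (use NM N2 in simp)
      then show "sqrt (s t) \<le> 2 * M * inverse (of_nat t)" using t by (simp add: field_simps)
    qed
    also have "\<dots> = 2 * M * harm (card B)" by (simp add: harm_def sum_distrib_left)
    also have "\<dots> \<le> 2 * M * (2 * L)"
      using harm_le_log[OF BA A2] NM N2 unfolding L_def N_def[symmetric] by (intro mult_left_mono) auto
    finally show ?thesis by simp
  qed
  have lower: "N ^ 3 \<le> 16416 * (P * \<sigma>)"
  proof -
    have "(card B * (card A)\<^sup>2)\<^sup>2 \<le> card ((\<lambda>(b, c, d). b * (c + d)) ` (B \<times> A \<times> A)) *
        (\<Sum>(b, b')\<in>B \<times> B. dilate_sols A (b / b'))"
      by (rule collisions_product_set[OF A finB B0])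
    also have "\<dots> \<le> card (sumprod_set A x) * (\<Sum>(b, b')\<in>B \<times> B. dilate_sols A (b / b'))"
    proof (intro mult_right_mono card_mono finite_sumprod_set[OF A])
      show "(\<lambda>(b, c, d). b * (c + d)) ` (B \<times> A \<times> A) \<subseteq> sumprod_set A x"
      proof clarify
        fix b c d assume *: "b \<in> B" "c \<in> A" "d \<in> A"
        then obtain a where "a \<in> A" "b = a + x" using B(1) by blast
        then have "b * (c + d) = (c + d) * (a + x)" by simp
        then show "b * (c + d) \<in> sumprod_set A x" using * \<open>a \<in> A\<close> unfolding sumprod_set_def by blast
      qed
    qed simp
    finally have "real ((card B * (card A)\<^sup>2)\<^sup>2) \<le> real (card (sumprod_set A x) * (\<Sum>(b, b')\<in>B \<times> B. dilate_sols A (b / b')))"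
      by (rule of_nat_mono)
    then have "(n * N\<^sup>2)\<^sup>2 \<le> real (card (sumprod_set A x)) * (\<Sum>(b, b')\<in>B \<times> B. real (dilate_sols A (b / b')))"
      by (simp add: n_def N_def split_beta)
    also have "\<dots> \<le> P * (\<Sum>(b, b')\<in>B \<times> B. real (dilate_sols A (b / b')))"
      using P(1) by (intro mult_right_mono sum_nonneg) auto
    also have "(\<Sum>(b, b')\<in>B \<times> B. real (dilate_sols A (b / b'))) = (\<Sum>t\<in>{1..card B}. \<Sum>q\<in>rich_ratios B t. real (dilate_sols A q))"
      by (rule sum_over_ratios[OF finB B0])
    finally have 1: "(n * N\<^sup>2)\<^sup>2 \<le> P * \<dots>" .
    have "(\<Sum>t\<in>{1..card B}. \<Sum>q\<in>rich_ratios B t. real (dilate_sols A q)) \<le> (\<Sum>t\<in>{1..card B}. 1026 * N ^ 3 * sqrt (s t))"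
    proof (rule sum_mono)
      fix t assume t: "t \<in> {1..card B}"
      \<comment> \<open>Since \<open>t \<ge> 1\<close>, the first moment supplies the size condition
        of \<open>sum_dilate_sols_le\<close>.\<close>
      have "card (rich_ratios B t) \<le> t * card (rich_ratios B t)" using t by simp
      also have "\<dots> \<le> (card B)\<^sup>2" by (rule rich_ratios_first_moment[OF finB B0])
      also have "\<dots> \<le> (card A)\<^sup>2" using BA by (rule power_mono) simp
      finally have c: "card (rich_ratios B t) \<le> (card A)\<^sup>2" .
      have z: "0 \<notin> rich_ratios B t" using B0 by (auto simp: rich_ratios_def ratio_set_def)
      show "(\<Sum>q\<in>rich_ratios B t. real (dilate_sols A q)) \<le> 1026 * N ^ 3 * sqrt (s t)"
        unfolding N_def s_def by (rule sum_dilate_sols_le[OF A finite_rich_ratios[OF finB] z c])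
    qed
    also have "\<dots> = 1026 * N ^ 3 * \<sigma>" by (simp add: \<sigma>_def sum_distrib_left)
    finally have "P * (\<Sum>t\<in>{1..card B}. \<Sum>q\<in>rich_ratios B t. real (dilate_sols A q)) \<le> P * (1026 * N ^ 3 * \<sigma>)"
      using MP NM N2 by (intro mult_left_mono) auto
    then have 2: "(n * N\<^sup>2)\<^sup>2 \<le> P * (1026 * N ^ 3 * \<sigma>)" using 1 by linarith
    have "(N * N\<^sup>2)\<^sup>2 \<le> (4 * n * N\<^sup>2)\<^sup>2" using nN N2 by (intro power_mono mult_right_mono) auto
    also have "\<dots> = 16 * (n * N\<^sup>2)\<^sup>2" by (simp add: power2_eq_square)
    also have "\<dots> \<le> 16 * (P * (1026 * N ^ 3 * \<sigma>))" by (rule mult_left_mono[OF 2]) simp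
    finally have "N ^ 3 * N ^ 3 \<le> N ^ 3 * (16416 * (P * \<sigma>))"
      by (simp add: power2_eq_square power3_eq_cube mult_ac)
    then show ?thesis by (rule mult_left_le_imp_le) (use N2 in simp)
  qed
  have Mu: "u\<^sup>2 * M = P\<^sup>2" using NM N2 by (simp add: u_def power_divide)
  have "N ^ 4 * N ^ 11 = (N ^ 3) ^ 5" by (simp flip: power_add power_mult)
  also have "\<dots> \<le> (16416 * (P * \<sigma>)) ^ 5" using lower N2 by (intro power_mono) auto
  \<comment> \<open>Four factors \<open>\<sigma>\<close> take the bound with \<open>sqrt u\<close>
    and one takes the bound with \<open>M * L\<close>. Then \<open>M\<close> enters only as
    \<open>u\<^sup>2 * M = P\<^sup>2\<close> and cancels.\<close>
  also have "\<dots> = 16416 ^ 5 * P ^ 5 * (\<sigma> ^ 4 * \<sigma>)"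
    by (simp add: power_mult_distrib eval_nat_numeral)
  also have "\<dots> \<le> 16416 ^ 5 * P ^ 5 * ((67 * N * sqrt u) ^ 4 * (4 * M * L))"
    using \<sigma>0 \<sigma>1 \<sigma>2 MP NM N2 by (intro mult_left_mono mult_mono power_mono) auto
  also have "(67 * N * sqrt u) ^ 4 = 67 ^ 4 * N ^ 4 * u\<^sup>2"
  proof -
    have "sqrt u ^ 4 = (sqrt u ^ 2) ^ 2" by (simp flip: power_mult)
    also have "\<dots> = u\<^sup>2" using u1 by simp
    finally show ?thesis by (simp add: power_mult_distrib)
  qed
  also have "16416 ^ 5 * P ^ 5 * (67 ^ 4 * N ^ 4 * u\<^sup>2 * (4 * M * L)) =
      N ^ 4 * (16416 ^ 5 * 67 ^ 4 * 4 * P ^ 5 * (u\<^sup>2 * M) * L)" by simp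
  also have "\<dots> = N ^ 4 * (16416 ^ 5 * 67 ^ 4 * 4 * P ^ 7 * L)"
    unfolding Mu by (simp flip: power_add)
  finally have "N ^ 11 \<le> 16416 ^ 5 * 67 ^ 4 * 4 * P ^ 7 * L"
    by (rule mult_left_le_imp_le) (use N2 in simp)
  then show ?thesis by (simp only: N_def L_def)
qed

text \<open>At most one element of \<open>A + x\<close> is zero, so the positive or the negative
  part has at least a quarter of the elements. The negative case is reflected through
  \<open>sumprod_set_neg\<close>.\<close>

lemma two_shifts_bound:
  fixes A :: "real set" and x y P :: real
  assumes A: "finite A" and A2: "2 \<le> card A" and xy: "x \<noteq> y"
    and P: "real (card (sumprod_set A x)) \<le> P" "real (card (sumprod_set A y)) \<le> P"
  shows "real (card A) ^ 11 \<le> 16416 ^ 5 * 67 ^ 4 * 4 * P ^ 7 * log 2 (card A)"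
proof -
  define X where "X = (\<lambda>a. a + x) ` A"
  define Xp Xn where "Xp = {v \<in> X. 0 < v}" and "Xn = {v \<in> X. v < 0}"
  have finX: "finite X" using A by (simp add: X_def)
  have "card A = card X" unfolding X_def by (rule card_image[symmetric]) (auto simp: inj_on_def)
  also have "\<dots> \<le> card (Xp \<union> Xn \<union> {0})"
    by (rule card_mono) (use finX in \<open>auto simp: Xp_def Xn_def\<close>)
  also have "\<dots> \<le> card Xp + card Xn + 1"
    using card_Un_le[of "Xp \<union> Xn" "{0}"] card_Un_le[of Xp Xn] by simp
  finally have "card A \<le> 4 * card Xp \<or> card A \<le> 4 * card Xn" using A2 by linarith
  then show ?thesis
  proof
    assume "card A \<le> 4 * card Xp"
    then show ?thesis
      by (intro two_shifts_bound_pos[OF A A2 xy _ _ _ P, of Xp]) (auto simp: Xp_def X_def)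
  next
    assume c: "card A \<le> 4 * card Xn"
    let ?A = "uminus ` A"
    have cA: "card ?A = card A" by (simp add: card_image)
    have "real (card ?A) ^ 11 \<le> 16416 ^ 5 * 67 ^ 4 * 4 * P ^ 7 * log 2 (card ?A)"
    proof (rule two_shifts_bound_pos[where B = "uminus ` Xn" and x = "- x" and y = "- y"])
      show "uminus ` Xn \<subseteq> (\<lambda>a. a + - x) ` ?A" by (auto simp: Xn_def X_def image_iff)
      show "card ?A \<le> 4 * card (uminus ` Xn)" using c by (simp add: card_image)
    qed (use A A2 xy P in \<open>auto simp: cA sumprod_set_neg Xn_def\<close>)
    then show ?thesis by (simp add: cA)
  qed
qed

section \<open>The exceptional shift and the final exponents\<close>

theorem theorem2p11:
  shows "\<exists>C::real. C > 0 \<and>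
    (\<forall>A :: real set. finite A \<longrightarrow>
      (\<exists>x0::real. \<forall>x::real. x \<noteq> x0 \<longrightarrow>
        real (card (sumprod_set A x)) \<ge>
          C * real (card A) powr (11/7) / (log 2 (real (card A))) powr (3/7)))"
proof -
  define K :: real where "K = 16416 ^ 5 * 67 ^ 4 * 4"
  \<comment> \<open>Chosen so that \<open>C ^ 7 * K = 1\<close>.\<close>
  define C where "C = K powr (- 1 / 7)"
  have K: "0 < K" by (simp add: K_def)
  have "C ^ 7 = K powr (- 1)" using K unfolding C_def by (subst powr_power) simp_all
  then have C: "0 < C" "C ^ 7 = 1 / K"
    using K by (simp_all add: C_def powr_minus_divide)
  have "\<exists>x0. \<forall>x. x \<noteq> x0 \<longrightarrow>
        C * real (card A) powr (11/7) / (log 2 (real (card A))) powr (3/7) \<le> real (card (sumprod_set A x))"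
    if A: "finite A" for A :: "real set"
  proof (cases "card A \<le> 1")
    case True
    then have "card A = 0 \<or> card A = 1" by auto
    \<comment> \<open>The bound is 0 here: for one element \<open>log 2 1 = 0\<close>, so the
      denominator is \<open>0 powr (3/7) = 0\<close> and division by zero yields 0; for none the
      numerator vanishes.\<close>
    then show ?thesis by auto
  next
    case False
    then have A2: "2 \<le> card A" by simp
    define N L where "N = real (card A)" and "L = log 2 N"
    define F where "F = C * N powr (11/7) / L powr (3/7)"
    have N2: "2 \<le> N" using A2 by (simp add: N_def)
    have L1: "1 \<le> L" using N2 by (simp add: L_def le_log_iff)
    \<comment> \<open>Seventh roots of the two-shift bound leave \<open>L\<close> to the power 1/7,
      whereas \<open>F\<close> has 3/7. The surplus \<open>L\<^sup>2\<close> is absorbed by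
      \<open>1 \<le> L\<close>.\<close>
    have F7: "F ^ 7 * K * L \<le> N ^ 11"
    proof -
      have "(N powr (11/7)) ^ 7 = N ^ 11" "(L powr (3/7)) ^ 7 = L ^ 3"
        using N2 L1 by (simp_all add: powr_power)
      then have "F ^ 7 = N ^ 11 / (K * L ^ 3)"
        by (simp add: F_def power_divide power_mult_distrib C)
      then have "F ^ 7 * K * L = N ^ 11 / L\<^sup>2"
        using K L1 by (simp add: field_simps power2_eq_square power3_eq_cube)
      also have "\<dots> \<le> N ^ 11" using L1 N2 by (simp add: divide_le_eq mult_le_cancel_left1)
      finally show ?thesis .
    qed
    have F0: "0 < F" using C N2 L1 by (simp add: F_def)
    have two: "F \<le> real (card (sumprod_set A x)) \<or> F \<le> real (card (sumprod_set A y))" if "x \<noteq> y" for x y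
    proof (rule ccontr)
      define P where "P = max (real (card (sumprod_set A x))) (real (card (sumprod_set A y)))"
      assume "\<not> ?thesis"
      then have "P < F" "0 \<le> P" by (auto simp: P_def)
      then have "P ^ 7 < F ^ 7" by (simp add: power_strict_mono)
      then have "K * P ^ 7 * L < K * F ^ 7 * L" using K L1 by simp
      also have "\<dots> \<le> N ^ 11" using F7 by (simp add: mult_ac)
      also have "\<dots> \<le> K * P ^ 7 * L"
        using two_shifts_bound[OF A A2 that, of P] unfolding N_def L_def K_def by (simp add: P_def)
      finally show False by simp
    qed
    show ?thesis
    \<comment> \<open>If some shift falls below \<open>F\<close>, it is the exception and
      \<open>two\<close> settles all others; if none does, any value serves as
      \<open>x0\<close>.\<close>
    proof (cases "\<exists>x0. real (card (sumprod_set A x0)) < F")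
      case True
      then obtain x0 where "real (card (sumprod_set A x0)) < F" by auto
      then show ?thesis using two[of _ x0] unfolding F_def N_def L_def by (meson not_le)
    next
      case False
      then show ?thesis unfolding F_def N_def L_def by (meson not_le)
    qed
  qed
  then show ?thesis using C(1) by blast
qed

end
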